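(* Let $H$ be a graph and let $\mathcal{F}$ be the disjoint union of graphs $F_1,F_2,\dots,F_r$, where $H$ and all $F_i$ have no isolated vertices. Let $I$ be the set of orders of $F_1,\dots,F_r$, i.e. $I=\{|V(F_l)|: l\in[r]\}$, let $n(\mathcal{F})$ be the maximum element of $I$, and let $k_i(\mathcal{F})$ be the number of graphs among $F_1,\dots,F_r$ with order $i$. Then $$R(\mathcal{F},H)\leq\max_{j\in I}\Bigg\{\max_{p\in[r],\,|V(F_p)|=j}R(F_p,H)+\sum_{i=j}^{n(\mathcal{F})}i\,k_i(\mathcal{F})-j\Bigg\}.$$ Moreover, if for each $i\in[r]$ the graph $F_i$ is connected and $H$-good with $|V(F_i)|\geq s(H)$, then $\mathcal{F}$ is $H$-good.
   Context: All graphs are finite, undirected, simple and nonempty, and $[r]=\{1,\dots,r\}$. $\chi(H)$ is the chromatic number; the chromatic surplus $s(H)$ is the minimum, over all proper colorings of $V(H)$ with $\chi(H)$ colors, of the number of vertices in a smallest color class. For graphs $G,H$, the Ramsey number $R(G,H)$ is the minimum integer $N$ such that any coloring of the edges of $K_N$ in red or blue yields a red copy of $G$ or a blue copy of $H$ (as a not necessarily induced subgraph). A connected graph $G$ with $|V(G)|\geq s(H)$ is $H$-good if $R(G,H)=(|V(G)|-1)(\chi(H)-1)+s(H)$. For a general (possibly disconnected) graph $\mathcal{F}$, let $I$ be the set of orders of its connected components, $n(\mathcal{F})=\max I$, and $k_i(\mathcal{F})$ the number of components of order $i$. Let $j_0\in I$ be the maximum integer at which $\max_{j\in I}\left\{(j-1)(\chi(H)-2)+\sum_{i=j}^{n(\mathcal{F})}i\,k_i(\mathcal{F})\right\}$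 is attained. Then $\mathcal{F}$ is $H$-good if $j_0\geq s(H)$ and $$R(\mathcal{F},H)=\max_{j\in I}\Bigg\{(j-1)(\chi(H)-2)+\sum_{i=j}^{n(\mathcal{F})}i\,k_i(\mathcal{F})\Bigg\}+s(H)-1.$$ For connected $\mathcal{F}$ this agrees with the previous definition. *)

theory Defs
  imports Complex_Main "HOL-Library.Ramsey"
begin

record 'a ugraph =
  verts :: "'a set"
  edges :: "'a set set"

definition simple_graph :: "'a ugraph \<Rightarrow> bool" where
  "simple_graph G \<longleftrightarrow>
     finite (verts G) \<and> verts G \<noteq> {} \<and> edges G \<subseteq> [verts G]\<^bsup>2\<^esup>"

definition no_isolated_verts :: "'a ugraph \<Rightarrow> bool" where
  "no_isolated_verts G \<longleftrightarrow> (\<forall>v\<in>verts G. \<exists>e\<in>edges G. v \<in> e)"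

(* The vertices are tagged with the index of the graph they come from, so the vertex
   sets of the graphs F l themselves may overlap. *)
definition disjoint_union :: "nat \<Rightarrow> (nat \<Rightarrow> 'a ugraph) \<Rightarrow> (nat \<times> 'a) ugraph" where
  "disjoint_union r F =
     \<lparr> verts = (SIGMA l:{1..r}. verts (F l)),
       edges = (\<Union>l\<in>{1..r}. (\<lambda>e. Pair l ` e) ` edges (F l)) \<rparr>"

definition reachable :: "'a ugraph \<Rightarrow> ('a \<times> 'a) set" where
  "reachable G = {(u, v). {u, v} \<in> edges G}\<^sup>*"

definition graph_connected :: "'a ugraph \<Rightarrow> bool" where
  "graph_connected G \<longleftrightarrow> (\<forall>u\<in>verts G. \<forall>v\<in>verts G. (u, v) \<in> reachable G)"

(* Components are represented by their vertex sets. *)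
definition graph_components :: "'a ugraph \<Rightarrow> 'a set set" where
  "graph_components G = (\<lambda>u. {v \<in> verts G. (u, v) \<in> reachable G}) ` verts G"

definition proper_coloring :: "'a ugraph \<Rightarrow> nat \<Rightarrow> ('a \<Rightarrow> nat) \<Rightarrow> bool" where
  "proper_coloring G c f \<longleftrightarrow>
     f ` verts G \<subseteq> {..<c} \<and> (\<forall>u v. {u, v} \<in> edges G \<longrightarrow> f u \<noteq> f v)"

definition chromatic_number :: "'a ugraph \<Rightarrow> nat" where
  "chromatic_number G = (LEAST c. \<exists>f. proper_coloring G c f)"

(* With chromatic_number G colors available, every color class of a proper coloring
   is nonempty. *)
definition chromatic_surplus :: "'a ugraph \<Rightarrow> nat" where
  "chromatic_surplus G =
     (LEAST m. \<exists>f. proper_coloring G (chromatic_number G) f \<and>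
        m = Min ((\<lambda>c. card {v \<in> verts G. f v = c}) ` {..<chromatic_number G}))"

(* K contains a not necessarily induced copy of G. *)
definition contains_copy :: "'b ugraph \<Rightarrow> 'a ugraph \<Rightarrow> bool" where
  "contains_copy K G \<longleftrightarrow>
     (\<exists>f. inj_on f (verts G) \<and> f ` verts G \<subseteq> verts K \<and> (\<forall>e\<in>edges G. f ` e \<in> edges K))"

(* A coloring of the edges of the complete graph on {..<N} is given by its set R of
   red edges. *)
definition arrows :: "nat \<Rightarrow> 'a ugraph \<Rightarrow> 'b ugraph \<Rightarrow> bool" where
  "arrows N G H \<longleftrightarrow>
     (\<forall>R \<subseteq> [{..<N}]\<^bsup>2\<^esup>.
        contains_copy \<lparr> verts = {..<N}, edges = R \<rparr> G \<or>
        contains_copy \<lparr> verts = {..<N}, edges = [{..<N}]\<^bsup>2\<^esup> - R \<rparr> H)"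

definition ramsey_number :: "'a ugraph \<Rightarrow> 'b ugraph \<Rightarrow> nat" where
  "ramsey_number G H = (LEAST N. arrows N G H)"

definition component_orders :: "'a ugraph \<Rightarrow> nat set" where
  "component_orders G = card ` graph_components G"

definition num_components :: "'a ugraph \<Rightarrow> nat \<Rightarrow> nat" where
  "num_components G i = card {C \<in> graph_components G. card C = i}"

(* Integer-valued, since chromatic_number H - 2 is negative for edgeless H. *)
definition good_term :: "'a ugraph \<Rightarrow> 'b ugraph \<Rightarrow> nat \<Rightarrow> int" where
  "good_term G H j =
     (int j - 1) * (int (chromatic_number H) - 2) +
     (\<Sum>i=j..Max (component_orders G). int i * int (num_components G i))"

definition good_max :: "'a ugraph \<Rightarrow> 'b ugraph \<Rightarrow> int" where
  "good_max G H = Max (good_term G H ` component_orders G)"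

definition good_argmax :: "'a ugraph \<Rightarrow> 'b ugraph \<Rightarrow> nat" where
  "good_argmax G H = Max {j \<in> component_orders G. good_term G H j = good_max G H}"

(* The definition for arbitrary graphs; for connected graphs it is the usual one, see
   ramsey_good_connected_iff below. *)
definition ramsey_good :: "'a ugraph \<Rightarrow> 'b ugraph \<Rightarrow> bool" where
  "ramsey_good G H \<longleftrightarrow>
     chromatic_surplus H \<le> good_argmax G H \<and>
     int (ramsey_number G H) = good_max G H + int (chromatic_surplus H) - 1"

lemma ramsey_good_connected_iff:
  assumes "simple_graph G" and "graph_connected G"
  shows "ramsey_good G H \<longleftrightarrow>
    chromatic_surplus H \<le> card (verts G) \<and>
    int (ramsey_number G H) =
      (int (card (verts G)) - 1) * (int (chromatic_number H) - 1) + int (chromatic_surplus H)"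
proof -
  have "{v \<in> verts G. (u, v) \<in> reachable G} = verts G" if "u \<in> verts G" for u
    using assms(2) that by (auto simp: graph_connected_def)
  then have comps: "graph_components G = {verts G}"
    using assms(1) by (auto simp: graph_components_def simple_graph_def)
  then have orders: "component_orders G = {card (verts G)}"
    by (simp add: component_orders_def)
  have "{C \<in> graph_components G. card C = card (verts G)} = {verts G}"
    using comps by auto
  then have num: "num_components G (card (verts G)) = 1"
    by (simp add: num_components_def)
  have max: "good_max G H =
      (int (card (verts G)) - 1) * (int (chromatic_number H) - 2) + int (card (verts G))"
    using num by (simp add: good_max_def orders good_term_def)
  have "{j \<in> component_orders G. good_term G H j = good_max G H} = {card (verts G)}"
    by (auto simp: good_max_def orders)
  then have "good_argmax G H = card (verts G)"
    by (simp add: good_argmax_def)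
  then show ?thesis
    by (simp add: ramsey_good_def max algebra_simps)
qed

end

theory Submission
  imports Defs
begin

text \<open>
  Both halves rest on simple constructions.

  For the upper bound, the graphs \<open>F l\<close> are embedded one after another in decreasing order of
  their sizes, in a red/blue colored complete graph without a blue copy of \<open>H\<close>. When it is the turn of a
  graph \<open>F p\<close> of order \<open>j\<close>, the vertices used so far belong to copies of graphs of order at
  least \<open>j\<close> other than \<open>F p\<close> itself, so there are at most \<open>(\<Sum>i=j..n. i * k i) - j\<close> of them. The bound
  leaves at least \<open>R(F p, H)\<close> free vertices, and a red copy of \<open>F p\<close> exists among these
  (\<open>greedy_embedding\<close>).

  Substituting the values \<open>R(F p, H) = (j - 1) * (\<chi>(H) - 1) + s(H)\<close> of the good case into this
  bound gives the formula that defines goodness of the union. For the matching lower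
  bound, let the blue graph be complete multipartite with \<open>\<chi>(H)\<close> parts: one has a vertex less than the
  graphs of order at least \<open>j\<close> have together, one has size \<open>s(H) - 1\<close>, and all others have size \<open>j - 1\<close>.
  There are two such special parts because \<open>H\<close> has an edge, so \<open>\<chi>(H) \<ge> 2\<close>.
  A blue \<open>H\<close> would be a coloring of \<open>H\<close> with a class smaller than the surplus. In a red copy of the
  union every connected graph of order at least \<open>j\<close> lies inside one part; as
  \<open>s(H) \<le> j\<close>, this can only be the large part, which is too small for all of them
  (\<open>multipartite_lower_bound\<close>).

  What remains is to identify the components of the union with the graphs \<open>F l\<close>.
\<close>

section \<open>Ramsey numbers\<close>

text \<open>Free choice of the vertex set: the upper bound uses the vertices left over
  by earlier steps, the lower bound uses pairs whose first entry names the part of a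
  multipartite graph.\<close>
lemma arrows_on_finite_set:
  assumes arr: "arrows N G H" and fin: "finite V" and le: "N \<le> card V"
  shows "contains_copy \<lparr>verts = V, edges = R\<rparr> G \<or>
         contains_copy \<lparr>verts = V, edges = [V]\<^bsup>2\<^esup> - R\<rparr> H"
proof -
  obtain g where g: "inj_on g {..<N}" "g ` {..<N} \<subseteq> V"
    using card_le_inj[of "{..<N}" V] fin le by auto
  define R' where "R' = {e \<in> [{..<N}]\<^bsup>2\<^esup>. g ` e \<in> R}"
  have "R' \<subseteq> [{..<N}]\<^bsup>2\<^esup>" by (auto simp: R'_def)
  then consider (red) "contains_copy \<lparr>verts = {..<N}, edges = R'\<rparr> G"
    | (blue) "contains_copy \<lparr>verts = {..<N}, edges = [{..<N}]\<^bsup>2\<^esup> - R'\<rparr> H"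
    using arr by (auto simp: arrows_def)
  then show ?thesis
  proof cases
    case red
    then obtain f where f: "inj_on f (verts G)" "f ` verts G \<subseteq> {..<N}"
      "\<forall>e\<in>edges G. f ` e \<in> R'"
      by (auto simp: contains_copy_def)
    have "inj_on (g \<circ> f) (verts G)"
      using f g by (meson comp_inj_on inj_on_subset)
    moreover have "(g \<circ> f) ` verts G \<subseteq> V" using f g by fastforce
    moreover have "\<forall>e\<in>edges G. (g \<circ> f) ` e \<in> R"
      using f(3) by (auto simp: R'_def image_image)
    ultimately have "contains_copy \<lparr>verts = V, edges = R\<rparr> G"
      unfolding contains_copy_def by (intro exI[of _ "g \<circ> f"]) auto
    then show ?thesis ..
  next
    case blue
    then obtain f where f: "inj_on f (verts H)" "f ` verts H \<subseteq> {..<N}"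
      "\<forall>e\<in>edges H. f ` e \<in> [{..<N}]\<^bsup>2\<^esup> - R'"
      by (auto simp: contains_copy_def)
    have "inj_on (g \<circ> f) (verts H)"
      using f g by (meson comp_inj_on inj_on_subset)
    moreover have "(g \<circ> f) ` verts H \<subseteq> V" using f g by fastforce
    moreover have "(g \<circ> f) ` e \<in> [V]\<^bsup>2\<^esup> - R" if "e \<in> edges H" for e
    proof -
      have fe: "f ` e \<in> [{..<N}]\<^bsup>2\<^esup>" "f ` e \<notin> R'" using f(3) that by auto
      then have sub: "f ` e \<subseteq> {..<N}" by (auto simp: nsets_def)
      have "g ` f ` e \<subseteq> V" using sub g by blast
      moreover have "card (g ` f ` e) = 2" "finite (g ` f ` e)"
        using fe sub g(1) by (auto simp: nsets_def card_image inj_on_subset)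
      ultimately show ?thesis
        using fe by (auto simp: R'_def nsets_def image_comp)
    qed
    ultimately have "contains_copy \<lparr>verts = V, edges = [V]\<^bsup>2\<^esup> - R\<rparr> H"
      unfolding contains_copy_def by (intro exI[of _ "g \<circ> f"]) auto
    then show ?thesis ..
  qed
qed

text \<open>Ramsey's theorem for complete graphs as large as \<open>G\<close> and \<open>H\<close>: every graph
  embeds in a clique with its number of vertices.\<close>
lemma arrows_ramsey_number:
  assumes G: "simple_graph G" and H: "simple_graph H"
  shows "arrows (ramsey_number G H) G H"
proof -
  have copy: "contains_copy \<lparr>verts = V, edges = E\<rparr> K"
    if K: "simple_graph K" and S: "S \<subseteq> V" "finite S" "card S = card (verts K)"
      and E: "[S]\<^bsup>2\<^esup> \<subseteq> E" for V :: "nat set" and E S and K :: "'c ugraph"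
  proof -
    obtain f where f: "bij_betw f (verts K) S"
      using finite_same_card_bij[of "verts K" S] K S by (auto simp: simple_graph_def)
    have "f ` e \<in> E" if "e \<in> edges K" for e
    proof -
      have e: "e \<subseteq> verts K" "finite e" "card e = 2"
        using K that by (auto simp: simple_graph_def nsets_def)
      have "f ` e \<subseteq> S" using e f by (auto simp: bij_betw_def)
      moreover have "card (f ` e) = 2"
        using e f by (metis bij_betw_def card_image inj_on_subset)
      ultimately have "f ` e \<in> [S]\<^bsup>2\<^esup>" using e by (auto simp: nsets_def)
      then show ?thesis using E by blast
    qed
    then show ?thesis
      using f S(1) unfolding contains_copy_def bij_betw_def by auto
  qed
  obtain N where N: "\<forall>(V::nat set) E. finite V \<and> N \<le> card V \<longrightarrow>
      (\<exists>S\<subseteq>V. card S = card (verts G) \<and> clique S E \<or> card S = card (verts H) \<and> indep S E)"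
    using ramsey2[of "card (verts G)" "card (verts H)"] by blast
  have "arrows N G H"
    unfolding arrows_def
  proof (intro allI impI)
    fix R assume "R \<subseteq> [{..<N}]\<^bsup>2\<^esup>"
    obtain S where S: "S \<subseteq> {..<N}"
      and "card S = card (verts G) \<and> clique S R \<or> card S = card (verts H) \<and> indep S R"
      using N[rule_format, of "{..<N}" R] by auto
    have finS: "finite S" using S finite_subset by blast
    from \<open>card S = _ \<and> clique S R \<or> _\<close>
    show "contains_copy \<lparr>verts = {..<N}, edges = R\<rparr> G \<or>
          contains_copy \<lparr>verts = {..<N}, edges = [{..<N}]\<^bsup>2\<^esup> - R\<rparr> H"
    proof
      assume a: "card S = card (verts G) \<and> clique S R"
      then have "[S]\<^bsup>2\<^esup> \<subseteq> R" by (auto simp: clique_def nsets_def card_2_iff)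
      then show ?thesis using copy[OF G S finS] a by blast
    next
      assume a: "card S = card (verts H) \<and> indep S R"
      then have "[S]\<^bsup>2\<^esup> \<subseteq> [{..<N}]\<^bsup>2\<^esup> - R"
        using S by (auto simp: indep_def nsets_def card_2_iff)
      then show ?thesis using copy[OF H S finS] a by blast
    qed
  qed
  then show ?thesis unfolding ramsey_number_def by (rule LeastI)
qed

lemma ramsey_number_le: "arrows N G H \<Longrightarrow> ramsey_number G H \<le> N"
  unfolding ramsey_number_def by (rule Least_le)

section \<open>The upper bound\<close>

text \<open>The set \<open>A\<close> grows by graphs of decreasing order, so for the last graph \<open>F p\<close> the sum in the
  hypothesis runs over all of \<open>A\<close>. It then says that at least \<open>R(F p, H)\<close> vertices are free
  once the others have been embedded.\<close>
lemma greedy_embedding: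
  fixes F :: "'i \<Rightarrow> 'a ugraph"
  assumes "finite A" and finV: "finite V"
    and noblue: "\<not> contains_copy \<lparr>verts = V, edges = [V]\<^bsup>2\<^esup> - R\<rparr> H"
    and H: "simple_graph H"
    and simple: "\<And>l. l \<in> A \<Longrightarrow> simple_graph (F l)"
    and room: "\<And>p. p \<in> A \<Longrightarrow> ramsey_number (F p) H +
        (\<Sum>l | l \<in> A \<and> card (verts (F p)) \<le> card (verts (F l)). card (verts (F l)))
      \<le> card V + card (verts (F p))"
  shows "\<exists>g. inj_on g (SIGMA l:A. verts (F l)) \<and> g ` (SIGMA l:A. verts (F l)) \<subseteq> V \<and>
      (\<forall>l\<in>A. \<forall>e\<in>edges (F l). g ` Pair l ` e \<in> R)"
  using \<open>finite A\<close> simple room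
proof (induction A rule: finite_ranking_induct[where f = "\<lambda>l. - int (card (verts (F l)))"])
  case empty
  then show ?case by auto
next
  case (insert p A)
  show ?case
  proof (cases "p \<in> A")
    case True
    then show ?thesis using insert by (simp add: insert_absorb)
  next
    case False
    let ?o = "\<lambda>l. card (verts (F l))"
    let ?U = "SIGMA l:A. verts (F l)"
    \<comment> \<open>Dropping \<open>p\<close> from the index set only shortens the sums.\<close>
    have room': "ramsey_number (F q) H + (\<Sum>l | l \<in> A \<and> ?o q \<le> ?o l. ?o l) \<le> card V + ?o q"
      if "q \<in> A" for q
    proof -
      have "(\<Sum>l | l \<in> A \<and> ?o q \<le> ?o l. ?o l) \<le> (\<Sum>l | l \<in> insert p A \<and> ?o q \<le> ?o l. ?o l)"
        using insert.hyps by (intro sum_mono2) auto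
      then show ?thesis using insert.prems(2)[of q] that by force
    qed
    have "\<exists>g. inj_on g ?U \<and> g ` ?U \<subseteq> V \<and>
        (\<forall>l\<in>A. \<forall>e\<in>edges (F l). g ` Pair l ` e \<in> R)"
      by (rule insert.IH) (use insert.prems(1) room' in blast)+
    then obtain g where g: "inj_on g ?U" "g ` ?U \<subseteq> V"
      and gR: "\<forall>l\<in>A. \<forall>e\<in>edges (F l). g ` Pair l ` e \<in> R"
      by blast
    define W where "W = V - g ` ?U"
    have "finite ?U"
      using insert by (auto simp: simple_graph_def)
    then have "card W = card V - (\<Sum>l\<in>A. ?o l)"
      using g insert unfolding W_def
      by (subst card_Diff_subset) (auto simp: card_image card_SigmaI simple_graph_def)
    moreover have "{l. l \<in> insert p A \<and> ?o p \<le> ?o l} = insert p A"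
      using insert.hyps by auto
    with insert.prems(2)[of p] have "ramsey_number (F p) H + (\<Sum>l\<in>A. ?o l) \<le> card V"
      using insert.hyps False by simp
    ultimately have "ramsey_number (F p) H \<le> card W" by simp
    moreover have "finite W" using finV by (simp add: W_def)
    ultimately have "contains_copy \<lparr>verts = W, edges = R\<rparr> (F p) \<or>
        contains_copy \<lparr>verts = W, edges = [W]\<^bsup>2\<^esup> - R\<rparr> H"
      using arrows_on_finite_set[OF arrows_ramsey_number[OF insert.prems(1) H]] by blast
    moreover have "[W]\<^bsup>2\<^esup> \<subseteq> [V]\<^bsup>2\<^esup>" by (auto simp: W_def nsets_def)
    then have "\<not> contains_copy \<lparr>verts = W, edges = [W]\<^bsup>2\<^esup> - R\<rparr> H"
      using noblue unfolding contains_copy_def W_def by fastforce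
    ultimately have "contains_copy \<lparr>verts = W, edges = R\<rparr> (F p)" by blast
    then obtain f where f: "inj_on f (verts (F p))" "f ` verts (F p) \<subseteq> W"
      "\<forall>e\<in>edges (F p). f ` e \<in> R"
      by (auto simp: contains_copy_def)
    define h where "h = (\<lambda>(l, x). if l = p then f x else g (l, x))"
    have "inj_on h (SIGMA l:insert p A. verts (F l))"
    proof (rule inj_onI)
      fix y z assume yz: "y \<in> (SIGMA l:insert p A. verts (F l))"
        "z \<in> (SIGMA l:insert p A. verts (F l))" "h y = h z"
      have "h x \<in> W \<longleftrightarrow> fst x = p" if "x \<in> (SIGMA l:insert p A. verts (F l))" for x
        using that f(2) by (force simp: h_def W_def)
      then have same: "fst y = p \<longleftrightarrow> fst z = p" using yz by metis
      show "y = z"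
      proof (cases "fst y = p")
        case True
        then have "f (snd y) = f (snd z)" "snd y \<in> verts (F p)" "snd z \<in> verts (F p)"
          using same yz by (auto simp: h_def)
        then show ?thesis using inj_onD[OF f(1)] True same by (simp add: prod_eq_iff)
      next
        case False
        then have "g y = g z" "y \<in> ?U" "z \<in> ?U"
          using same yz by (auto simp: h_def)
        then show ?thesis by (rule inj_onD[OF g(1)])
      qed
    qed
    moreover have "h ` (SIGMA l:insert p A. verts (F l)) \<subseteq> V"
    proof -
      have "f v \<in> V" if "v \<in> verts (F p)" for v using f(2) that by (auto simp: W_def)
      moreover have "g x \<in> V" if "x \<in> ?U" for x using g(2) that by blast
      ultimately show ?thesis by (auto simp: h_def)
    qed
    moreover have "h ` Pair l ` e \<in> R" if "l \<in> insert p A" "e \<in> edges (F l)" for l e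
    proof (cases "l = p")
      case True
      then have "h ` Pair l ` e = f ` e" by (auto simp: h_def image_image)
      then show ?thesis using f(3) that True by auto
    next
      case False
      then have "h ` Pair l ` e = g ` Pair l ` e" by (auto simp: h_def image_image)
      then show ?thesis using gR that False by auto
    qed
    ultimately show ?thesis by blast
  qed
qed

definition sum_of_orders_from :: "nat \<Rightarrow> (nat \<Rightarrow> 'a ugraph) \<Rightarrow> nat \<Rightarrow> nat" where
  "sum_of_orders_from r F j =
     (\<Sum>l | l \<in> {1..r} \<and> j \<le> card (verts (F l)). card (verts (F l)))"

lemma arrows_disjoint_union:
  assumes "simple_graph H" and "\<And>l. l \<in> {1..r} \<Longrightarrow> simple_graph (F l)"
    and "\<And>p. p \<in> {1..r} \<Longrightarrow> ramsey_number (F p) H + sum_of_orders_from r F (card (verts (F p)))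
      \<le> N + card (verts (F p))"
  shows "arrows N (disjoint_union r F) H"
  unfolding arrows_def
proof (intro allI impI)
  fix R assume "R \<subseteq> [{..<N}]\<^bsup>2\<^esup>"
  show "contains_copy \<lparr>verts = {..<N}, edges = R\<rparr> (disjoint_union r F) \<or>
        contains_copy \<lparr>verts = {..<N}, edges = [{..<N}]\<^bsup>2\<^esup> - R\<rparr> H"
  proof (rule disjCI)
    assume noblue: "\<not> contains_copy \<lparr>verts = {..<N}, edges = [{..<N}]\<^bsup>2\<^esup> - R\<rparr> H"
    have "\<exists>g. inj_on g (SIGMA l:{1..r}. verts (F l)) \<and>
        g ` (SIGMA l:{1..r}. verts (F l)) \<subseteq> {..<N} \<and>
        (\<forall>l\<in>{1..r}. \<forall>e\<in>edges (F l). g ` Pair l ` e \<in> R)"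
      by (rule greedy_embedding[OF _ _ noblue])
        (use assms in \<open>auto simp: sum_of_orders_from_def\<close>)
    then show "contains_copy \<lparr>verts = {..<N}, edges = R\<rparr> (disjoint_union r F)"
      unfolding contains_copy_def disjoint_union_def by fastforce
  qed
qed

lemma sum_of_orders_from_eq_sum:
  assumes "n = Max ((\<lambda>l. card (verts (F l))) ` {1..r})"
  shows "int (sum_of_orders_from r F j) =
    (\<Sum>i=j..n. int i * int (card {l \<in> {1..r}. card (verts (F l)) = i}))"
proof -
  let ?o = "\<lambda>l. card (verts (F l))"
  let ?S = "{l \<in> {1..r}. j \<le> ?o l}"
  have "?o ` ?S \<subseteq> {j..n}" using assms by auto
  then have "(\<Sum>l\<in>?S. ?o l) = (\<Sum>i=j..n. \<Sum>l | l \<in> ?S \<and> ?o l = i. ?o l)"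
    by (intro sum.group[symmetric]) auto
  also have "\<dots> = (\<Sum>i=j..n. i * card {l \<in> {1..r}. ?o l = i})"
  proof (rule sum.cong[OF refl])
    fix i assume "i \<in> {j..n}"
    then have "{l. l \<in> ?S \<and> ?o l = i} = {l \<in> {1..r}. ?o l = i}" by auto
    moreover have "(\<Sum>l | l \<in> {1..r} \<and> ?o l = i. ?o l) = (\<Sum>l | l \<in> {1..r} \<and> ?o l = i. i)"
      by (rule sum.cong) auto
    ultimately show "(\<Sum>l | l \<in> ?S \<and> ?o l = i. ?o l) = i * card {l \<in> {1..r}. ?o l = i}"
      by simp
  qed
  finally show ?thesis by (simp add: sum_of_orders_from_def)
qed

section \<open>Chromatic number and surplus\<close>

lemma simple_graph_edgeD:
  assumes "simple_graph G" and "{u, v} \<in> edges G"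
  shows "u \<noteq> v" and "u \<in> verts G" and "v \<in> verts G"
proof -
  have "{u, v} \<in> [verts G]\<^bsup>2\<^esup>" using assms unfolding simple_graph_def by blast
  then show "u \<noteq> v" "u \<in> verts G" "v \<in> verts G" by (auto simp: nsets_def)
qed

lemma chromatic_number_attained:
  assumes "simple_graph H"
  shows "\<exists>f. proper_coloring H (chromatic_number H) f"
proof -
  obtain f :: "'a \<Rightarrow> nat" and c where f: "f ` verts H = {i. i < c}" "inj_on f (verts H)"
    using finite_imp_inj_to_nat_seg[of "verts H"] assms by (auto simp: simple_graph_def)
  have "f u \<noteq> f v" if "{u, v} \<in> edges H" for u v
  proof -
    have "u \<noteq> v" "u \<in> verts H" "v \<in> verts H"
      using simple_graph_edgeD[OF assms that] by auto
    then show ?thesis using f(2) by (auto simp: inj_on_def)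
  qed
  then have "proper_coloring H c f" using f(1) by (auto simp: proper_coloring_def)
  then have "\<exists>c f. proper_coloring H c f" by blast
  then show ?thesis unfolding chromatic_number_def by (rule LeastI_ex)
qed

lemma chromatic_number_ge_2:
  assumes "simple_graph H" and "no_isolated_verts H"
  shows "2 \<le> chromatic_number H"
proof -
  obtain e where e: "e \<in> edges H"
    using assms by (auto simp: simple_graph_def no_isolated_verts_def)
  then have "e \<in> [verts H]\<^bsup>2\<^esup>" using assms(1) by (auto simp: simple_graph_def)
  then obtain u v where uv: "e = {u, v}" "u \<in> verts H" "v \<in> verts H"
    by (auto simp: nsets_def card_2_iff)
  obtain f where "proper_coloring H (chromatic_number H) f"
    using chromatic_number_attained assms(1) by blast
  then have "f u \<noteq> f v" "f u < chromatic_number H" "f v < chromatic_number H"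
    using e uv by (auto simp: proper_coloring_def)
  then show ?thesis by linarith
qed

lemma chromatic_surplus_le_class:
  assumes "proper_coloring H (chromatic_number H) f" and "c < chromatic_number H"
  shows "chromatic_surplus H \<le> card {v \<in> verts H. f v = c}"
proof -
  have "chromatic_surplus H \<le>
      Min ((\<lambda>c. card {v \<in> verts H. f v = c}) ` {..<chromatic_number H})"
    unfolding chromatic_surplus_def using assms(1) by (intro Least_le) auto
  also have "\<dots> \<le> card {v \<in> verts H. f v = c}"
    using assms(2) by (intro Min_le) auto
  finally show ?thesis .
qed

text \<open>Surplus 0 would mean an empty color class, whose color could replace the last one and thus
  save a color.\<close>
lemma chromatic_surplus_pos:
  assumes H: "simple_graph H" and pos: "0 < chromatic_number H"
  shows "0 < chromatic_surplus H"
proof (rule ccontr)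
  let ?\<chi> = "chromatic_number H"
  let ?sizes = "\<lambda>f. (\<lambda>c. card {v \<in> verts H. f v = c}) ` {..<?\<chi>}"
  assume "\<not> 0 < chromatic_surplus H"
  moreover have "\<exists>f. proper_coloring H ?\<chi> f \<and> chromatic_surplus H = Min (?sizes f)"
    unfolding chromatic_surplus_def
    by (rule LeastI_ex) (use chromatic_number_attained[OF H] in blast)
  ultimately obtain f where f: "proper_coloring H ?\<chi> f" and "Min (?sizes f) = 0"
    by auto
  moreover have "Min (?sizes f) \<in> ?sizes f" using pos by (intro Min_in) auto
  ultimately obtain c where c: "c < ?\<chi>" "card {v \<in> verts H. f v = c} = 0" by auto
  then have empty: "f v \<noteq> c" if "v \<in> verts H" for v
    using H that by (auto simp: simple_graph_def)
  define g where "g = (\<lambda>v. if f v = ?\<chi> - 1 then c else f v)"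
  have "g v < ?\<chi> - 1" if "v \<in> verts H" for v
  proof -
    have "f v < ?\<chi>" using f that by (auto simp: proper_coloring_def)
    then show ?thesis using c(1) empty[OF that] by (auto simp: g_def)
  qed
  moreover have "g u \<noteq> g v" if "{u, v} \<in> edges H" for u v
  proof -
    have "u \<in> verts H" "v \<in> verts H" using simple_graph_edgeD[OF H that] by auto
    moreover have "f u \<noteq> f v" using f that by (auto simp: proper_coloring_def)
    ultimately show ?thesis using empty by (auto simp: g_def)
  qed
  ultimately have "proper_coloring H (?\<chi> - 1) g" by (auto simp: proper_coloring_def)
  then have "?\<chi> \<le> ?\<chi> - 1"
    by (subst (1) chromatic_number_def) (intro Least_le, blast)
  then show False using pos by simp
qed

section \<open>The lower bound\<close>

text \<open>A function that is constant along edges is constant on a connected graph. It will be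
  applied to the part of a multipartite graph in which a vertex is placed.\<close>
lemma constant_on_connected:
  assumes "graph_connected G" and "\<And>u v. {u, v} \<in> edges G \<Longrightarrow> q u = q v"
    and "u \<in> verts G" and "v \<in> verts G"
  shows "q u = q v"
proof -
  have "(u, v) \<in> {(u, v). {u, v} \<in> edges G}\<^sup>*"
    using assms by (auto simp: graph_connected_def reachable_def)
  then show ?thesis
    by (induction rule: rtrancl_induct) (use assms(2) in auto)
qed

text \<open>The vertices of part \<open>i\<close> are the pairs \<open>(i, x)\<close> with \<open>x < a i\<close>, and an edge is red iff it
  stays within a part. Part 0 is the large one, the last part is the one of size \<open>s(H) - 1\<close>.\<close>
lemma multipartite_lower_bound:
  fixes F :: "nat \<Rightarrow> 'a ugraph" and H :: "'b ugraph"
  assumes H: "simple_graph H" and chi: "2 \<le> chromatic_number H"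
    and simple: "\<And>l. l \<in> {1..r} \<Longrightarrow> simple_graph (F l)"
    and conn: "\<And>l. l \<in> {1..r} \<Longrightarrow> graph_connected (F l)"
    and large: "\<exists>l\<in>{1..r}. j \<le> card (verts (F l))"
    and surplus: "chromatic_surplus H \<le> j"
    and arr: "arrows N (disjoint_union r F) H"
  shows "(j - 1) * (chromatic_number H - 2) + sum_of_orders_from r F j + chromatic_surplus H
    \<le> N + 1"
proof (rule ccontr)
  assume small: "\<not> ?thesis"
  let ?o = "\<lambda>l. card (verts (F l))"
  let ?\<chi> = "chromatic_number H"
  let ?s = "chromatic_surplus H"
  let ?L = "{l \<in> {1..r}. j \<le> ?o l}"
  define t where "t = sum_of_orders_from r F j"
  have s: "0 < ?s" using chromatic_surplus_pos[OF H] chi by simp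
  have tU: "t = card (SIGMA l:?L. verts (F l))"
    using simple unfolding t_def sum_of_orders_from_def
    by (subst card_SigmaI) (auto simp: simple_graph_def)
  have "0 < t"
  proof -
    obtain l where "l \<in> ?L" using large by auto
    then have "?o l \<le> t"
      unfolding t_def sum_of_orders_from_def by (intro member_le_sum) auto
    then show ?thesis using \<open>l \<in> ?L\<close> surplus s by auto
  qed
  define a where "a = (\<lambda>i. if i = 0 then t - 1 else if i = ?\<chi> - 1 then ?s - 1 else j - 1)"
  define V where "V = (SIGMA i:{..<?\<chi>}. {..<a i})"
  define R :: "(nat \<times> nat) set set" where "R = {e. \<exists>i. fst ` e \<subseteq> {i}}"
  have "finite V" by (simp add: V_def)
  have "card V = (\<Sum>i<?\<chi>. a i)" by (simp add: V_def card_SigmaI)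
  also have "{..<?\<chi>} = insert 0 (insert (?\<chi> - 1) {1..<?\<chi> - 1})" using chi by auto
  also have "(\<Sum>i\<in>\<dots>. a i) = t - 1 + (?s - 1) + (\<Sum>i\<in>{1..<?\<chi> - 1}. a i)"
    using chi by (simp add: a_def)
  also have "(\<Sum>i\<in>{1..<?\<chi> - 1}. a i) = (\<Sum>i\<in>{1..<?\<chi> - 1}. j - 1)"
    by (rule sum.cong) (auto simp: a_def)
  also have "\<dots> = (j - 1) * (?\<chi> - 2)" by (simp add: numeral_2_eq_2)
  finally have "N \<le> card V"
    using small s \<open>0 < t\<close> unfolding t_def by linarith
  from arrows_on_finite_set[OF arr \<open>finite V\<close> this, of R] show False
  proof
    assume "contains_copy \<lparr>verts = V, edges = R\<rparr> (disjoint_union r F)"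
    then obtain g where inj: "inj_on g (SIGMA l:{1..r}. verts (F l))"
      and gV: "g ` (SIGMA l:{1..r}. verts (F l)) \<subseteq> V"
      and gR: "\<And>l e. l \<in> {1..r} \<Longrightarrow> e \<in> edges (F l) \<Longrightarrow> g ` Pair l ` e \<in> R"
      by (auto simp: contains_copy_def disjoint_union_def)
    \<comment> \<open>A copy of a graph with at least \<open>j\<close> vertices does not fit into the other parts, which have
      at most \<open>j - 1\<close> vertices each because \<open>s(H) \<le> j\<close>.\<close>
    have part: "fst (g (l, v)) = 0" if l: "l \<in> ?L" and v: "v \<in> verts (F l)" for l v
    proof (rule ccontr)
      let ?i = "fst (g (l, v))"
      assume nz: "?i \<noteq> 0"
      have same: "fst (g (l, u)) = ?i" if "u \<in> verts (F l)" for u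
        by (rule constant_on_connected[where G = "F l" and q = "\<lambda>u. fst (g (l, u))"])
          (use conn l v that gR[of l] in \<open>force simp: R_def\<close>)+
      have "g (l, u) \<in> {?i} \<times> {..<a ?i}" if "u \<in> verts (F l)" for u
      proof -
        have "g (l, u) \<in> V" using gV l that by auto
        then show ?thesis
          using same[OF that] by (cases "g (l, u)") (auto simp: V_def)
      qed
      moreover have "inj_on (\<lambda>u. g (l, u)) (verts (F l))"
        using inj l by (auto simp: inj_on_def)
      ultimately have "?o l \<le> card ({?i} \<times> {..<a ?i})"
        by (intro card_inj_on_le[of "\<lambda>u. g (l, u)"]) blast+
      then show False
        using l nz surplus s by (auto simp: a_def split: if_splits)
    qed
    have "g x \<in> {0} \<times> {..<a 0}" if "x \<in> (SIGMA l:?L. verts (F l))" for x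
    proof -
      have "g x \<in> V" using gV that by auto
      moreover have "fst (g x) = 0" using part that by auto
      ultimately show ?thesis by (cases "g x") (auto simp: V_def)
    qed
    moreover have "inj_on g (SIGMA l:?L. verts (F l))"
      using inj by (rule inj_on_subset) auto
    ultimately have "t \<le> card ({0::nat} \<times> {..<a 0})"
      unfolding tU by (intro card_inj_on_le[of g]) blast+
    then show False using \<open>0 < t\<close> by (simp add: a_def)
  next
    assume "contains_copy \<lparr>verts = V, edges = [V]\<^bsup>2\<^esup> - R\<rparr> H"
    then obtain f where inj: "inj_on f (verts H)" and fV: "f ` verts H \<subseteq> V"
      and fR: "\<And>e. e \<in> edges H \<Longrightarrow> f ` e \<notin> R"
      by (auto simp: contains_copy_def)
    have "fst (f u) \<noteq> fst (f v)" if "{u, v} \<in> edges H" for u v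
      using fR[OF that] by (auto simp: R_def)
    moreover have "(fst \<circ> f) ` verts H \<subseteq> {..<?\<chi>}" using fV by (force simp: V_def)
    ultimately have "proper_coloring H ?\<chi> (fst \<circ> f)" by (auto simp: proper_coloring_def)
    from chromatic_surplus_le_class[OF this]
    have "?s \<le> card {v \<in> verts H. (fst \<circ> f) v = ?\<chi> - 1}"
      using chi by simp
    also have "\<dots> \<le> card ({?\<chi> - 1} \<times> {..<a (?\<chi> - 1)})"
    proof (rule card_inj_on_le)
      show "inj_on f {v \<in> verts H. (fst \<circ> f) v = ?\<chi> - 1}"
        using inj by (rule inj_on_subset) auto
      show "f ` {v \<in> verts H. (fst \<circ> f) v = ?\<chi> - 1} \<subseteq> {?\<chi> - 1} \<times> {..<a (?\<chi> - 1)}"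
        using fV by (force simp: V_def)
    qed auto
    finally show False using s chi by (simp add: a_def)
  qed
qed

section \<open>Components of a disjoint union\<close>

lemma reachable_disjoint_union:
  assumes "l \<in> {1..r}" and "(u, v) \<in> reachable (F l)"
  shows "((l, u), (l, v)) \<in> reachable (disjoint_union r F)"
  using assms(2) unfolding reachable_def
proof (induction rule: rtrancl_induct)
  case base
  show ?case by simp
next
  case (step v w)
  have "Pair l ` {v, w} \<in> edges (disjoint_union r F)"
    using step(2) assms(1) unfolding disjoint_union_def ugraph.simps by blast
  then have "{(l, v), (l, w)} \<in> edges (disjoint_union r F)" by simp
  then show ?case using step.IH by (auto intro: rtrancl_into_rtrancl)
qed

lemma reachable_disjoint_union_same_index:
  assumes "(x, y) \<in> reachable (disjoint_union r F)"
  shows "fst x = fst y"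
  using assms unfolding reachable_def
proof (induction rule: rtrancl_induct)
  case (step y z)
  then obtain l e where "{y, z} = Pair l ` e" by (auto simp: disjoint_union_def)
  then have "y \<in> Pair l ` e" "z \<in> Pair l ` e" by blast+
  then show ?case using step.IH by auto
qed simp

lemma graph_components_disjoint_union:
  assumes simple: "\<forall>l\<in>{1..r}. simple_graph (F l)"
    and conn: "\<forall>l\<in>{1..r}. graph_connected (F l)"
  shows "graph_components (disjoint_union r F) = (\<lambda>l. {l} \<times> verts (F l)) ` {1..r}"
proof -
  let ?D = "disjoint_union r F"
  have comp: "{y \<in> verts ?D. ((l, u), y) \<in> reachable ?D} = {l} \<times> verts (F l)"
    if "l \<in> {1..r}" "u \<in> verts (F l)" for l u
  proof -
    have "((l, u), (l, v)) \<in> reachable ?D" if "v \<in> verts (F l)" for v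
      using conn \<open>l \<in> _\<close> \<open>u \<in> _\<close> that
      by (auto simp: graph_connected_def intro: reachable_disjoint_union)
    then show ?thesis
      using that(1) reachable_disjoint_union_same_index[of "(l, u)" _ r F]
      by (fastforce simp: disjoint_union_def)
  qed
  have "verts (F l) \<noteq> {}" if "l \<in> {1..r}" for l
    using simple that by (auto simp: simple_graph_def)
  then show ?thesis
    unfolding graph_components_def using comp
    by (fastforce simp: disjoint_union_def image_iff)
qed

lemma component_orders_disjoint_union:
  assumes "\<forall>l\<in>{1..r}. simple_graph (F l)"
    and "\<forall>l\<in>{1..r}. graph_connected (F l)"
  shows "component_orders (disjoint_union r F) = (\<lambda>l. card (verts (F l))) ` {1..r}"
  unfolding component_orders_def graph_components_disjoint_union[OF assms] image_image
  by (simp add: card_cartesian_product_singleton)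

lemma num_components_disjoint_union:
  assumes simple: "\<forall>l\<in>{1..r}. simple_graph (F l)"
    and conn: "\<forall>l\<in>{1..r}. graph_connected (F l)"
  shows "num_components (disjoint_union r F) i = card {l \<in> {1..r}. card (verts (F l)) = i}"
proof -
  let ?C = "\<lambda>l. {l} \<times> verts (F l)"
  have "{C \<in> graph_components (disjoint_union r F). card C = i} =
      ?C ` {l \<in> {1..r}. card (verts (F l)) = i}"
    unfolding graph_components_disjoint_union[OF assms]
    by (auto simp: card_cartesian_product_singleton)
  moreover have "inj_on ?C {1..r}"
  proof (rule inj_onI)
    fix l m assume "l \<in> {1..r}" "?C l = ?C m"
    moreover have "verts (F l) \<noteq> {}"
      using simple \<open>l \<in> _\<close> by (auto simp: simple_graph_def)
    ultimately show "l = m" by blast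
  qed
  then have "inj_on ?C {l \<in> {1..r}. card (verts (F l)) = i}"
    by (rule inj_on_subset) auto
  ultimately show ?thesis by (simp add: num_components_def card_image)
qed

lemma good_term_disjoint_union:
  assumes "\<forall>l\<in>{1..r}. simple_graph (F l)"
    and "\<forall>l\<in>{1..r}. graph_connected (F l)"
  shows "good_term (disjoint_union r F) H j =
    (int j - 1) * (int (chromatic_number H) - 2) + int (sum_of_orders_from r F j)"
  unfolding good_term_def component_orders_disjoint_union[OF assms]
    num_components_disjoint_union[OF assms] sum_of_orders_from_eq_sum[OF refl] ..

section \<open>The Ramsey number of a disjoint union\<close>

theorem theorem4p3:
  fixes H :: "'b ugraph" and F :: "nat \<Rightarrow> 'a ugraph" and r :: nat
    and I :: "nat set" and n :: nat and k :: "nat \<Rightarrow> nat"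
  assumes "simple_graph H" and "no_isolated_verts H"
    and "r \<ge> 1"
    and "\<And>l. l \<in> {1..r} \<Longrightarrow> simple_graph (F l)"
    and "\<And>l. l \<in> {1..r} \<Longrightarrow> no_isolated_verts (F l)"
    and I_def: "I = (\<lambda>l. card (verts (F l))) ` {1..r}"
    and n_def: "n = Max I"
    and k_def: "k = (\<lambda>i. card {l \<in> {1..r}. card (verts (F l)) = i})"
  shows "int (ramsey_number (disjoint_union r F) H) \<le>
           Max ((\<lambda>j. Max ((\<lambda>p. int (ramsey_number (F p) H)) ` {p \<in> {1..r}. card (verts (F p)) = j})
                     + (\<Sum>i=j..n. int i * int (k i)) - int j) ` I)
         \<and> ((\<forall>i\<in>{1..r}. graph_connected (F i) \<and> ramsey_good (F i) H \<and>
                card (verts (F i)) \<ge> chromatic_surplus H)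
            \<longrightarrow> ramsey_good (disjoint_union r F) H)"
proof -
  let ?D = "disjoint_union r F"
  let ?o = "\<lambda>l. card (verts (F l))"
  let ?s = "chromatic_surplus H"
  let ?\<chi> = "chromatic_number H"
  let ?M = "\<lambda>j. Max ((\<lambda>p. int (ramsey_number (F p) H)) ` {p \<in> {1..r}. card (verts (F p)) = j})"
  let ?B = "\<lambda>j. ?M j + (\<Sum>i=j..n. int i * int (k i)) - int j"
  note H = assms(1) and simple = assms(4)
  have total: "(\<Sum>i=j..n. int i * int (k i)) = int (sum_of_orders_from r F j)" for j
    using sum_of_orders_from_eq_sum[of n F r j] by (simp add: n_def I_def k_def)
  have finI: "finite I" and neI: "I \<noteq> {}" using assms(3) by (auto simp: I_def)
  have bound: "int (ramsey_number (F p) H) + int (sum_of_orders_from r F (?o p)) - int (?o p)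
      \<le> Max (?B ` I)" if p: "p \<in> {1..r}" for p
  proof -
    have "int (ramsey_number (F p) H) \<le> ?M (?o p)" using p by (intro Max_ge) auto
    then have "int (ramsey_number (F p) H) + int (sum_of_orders_from r F (?o p)) - int (?o p)
        \<le> ?B (?o p)"
      by (simp add: total)
    also have "\<dots> \<le> Max (?B ` I)" using finI p by (intro Max_ge) (auto simp: I_def)
    finally show ?thesis .
  qed
  \<comment> \<open>The maximum has to be converted to a natural number, the number of vertices of the
    colored complete graph.\<close>
  have nonneg: "0 \<le> Max (?B ` I)"
  proof -
    have r: "r \<in> {1..r}" using assms(3) by simp
    then have "?o r \<le> sum_of_orders_from r F (?o r)"
      unfolding sum_of_orders_from_def by (intro member_le_sum) auto
    then show ?thesis using bound[OF r] by linarith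
  qed
  have arr: "arrows (nat (Max (?B ` I))) ?D H"
  proof (rule arrows_disjoint_union[OF H])
    fix p assume "p \<in> {1..r}"
    from bound[OF this] nonneg
    show "ramsey_number (F p) H + sum_of_orders_from r F (?o p) \<le> nat (Max (?B ` I)) + ?o p"
      by linarith
  qed (rule simple)
  then have "ramsey_number ?D H \<le> nat (Max (?B ` I))" by (rule ramsey_number_le)
  then have upper: "int (ramsey_number ?D H) \<le> Max (?B ` I)" using nonneg by linarith
  moreover have "ramsey_good ?D H"
    if good: "\<forall>i\<in>{1..r}. graph_connected (F i) \<and> ramsey_good (F i) H \<and> ?o i \<ge> ?s"
  proof -
    have conn: "graph_connected (F l)" if "l \<in> {1..r}" for l using good that by blast
    have simple': "\<forall>l\<in>{1..r}. simple_graph (F l)" using simple by blast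
    have conn': "\<forall>l\<in>{1..r}. graph_connected (F l)" using conn by blast
    have orders: "component_orders ?D = I"
      using component_orders_disjoint_union[OF simple' conn'] by (simp add: I_def)
    note term_eq = good_term_disjoint_union[OF simple' conn']
    have sI: "?s \<le> j" if "j \<in> I" for j using good that by (auto simp: I_def)
    have "good_max ?D H \<in> good_term ?D H ` I"
      unfolding good_max_def orders using finI neI by (intro Max_in) auto
    then obtain j where j: "j \<in> I" "good_term ?D H j = good_max ?D H" by force
    have "good_argmax ?D H \<in> {j \<in> I. good_term ?D H j = good_max ?D H}"
      unfolding good_argmax_def orders using j finI by (intro Max_in) auto
    then have "?s \<le> good_argmax ?D H" using sI by auto
    \<comment> \<open>All good graphs of order \<open>i\<close> have the same Ramsey number \<open>(i - 1) * (\<chi>(H) - 1) + s(H)\<close>.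
      Subtracting \<open>i\<close> turns the factor \<open>\<chi>(H) - 1\<close> into \<open>\<chi>(H) - 2\<close> and leaves \<open>-1\<close>.\<close>
    moreover have "?B i \<le> good_max ?D H + int ?s - 1" if "i \<in> I" for i
    proof -
      have "int (ramsey_number (F p) H) = (int i - 1) * (int ?\<chi> - 1) + int ?s"
        if "p \<in> {1..r}" "?o p = i" for p
        using good that ramsey_good_connected_iff[of "F p" H] simple by auto
      moreover have "\<exists>p\<in>{1..r}. ?o p = i" using \<open>i \<in> I\<close> by (auto simp: I_def)
      ultimately have "(\<lambda>p. int (ramsey_number (F p) H)) ` {p \<in> {1..r}. ?o p = i} =
          {(int i - 1) * (int ?\<chi> - 1) + int ?s}"
        by (auto simp: image_iff)
      then have "?B i = good_term ?D H i + int ?s - 1"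
        by (simp add: total term_eq algebra_simps)
      moreover have "good_term ?D H i \<le> good_max ?D H"
        unfolding good_max_def orders using finI that by (intro Max_ge) auto
      ultimately show ?thesis by simp
    qed
    then have "Max (?B ` I) \<le> good_max ?D H + int ?s - 1"
      using finI neI by (subst Max_le_iff) auto
    moreover have "good_max ?D H + int ?s - 1 \<le> int (ramsey_number ?D H)"
    proof -
      have \<chi>: "2 \<le> ?\<chi>" using chromatic_number_ge_2 assms(1,2) by blast
      have "arrows (ramsey_number ?D H) ?D H"
        unfolding ramsey_number_def using arr by (rule LeastI)
      then have "(j - 1) * (?\<chi> - 2) + sum_of_orders_from r F j + ?s \<le> ramsey_number ?D H + 1"
        using j(1) sI by (intro multipartite_lower_bound H \<chi> simple conn) (auto simp: I_def)
      then have "int ((j - 1) * (?\<chi> - 2)) + int (sum_of_orders_from r F j) + int ?s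
          \<le> int (ramsey_number ?D H) + 1"
        by linarith
      moreover have "1 \<le> j" using sI[OF j(1)] chromatic_surplus_pos[OF H] \<chi> by linarith
      ultimately show ?thesis
        using \<chi> by (simp add: j(2)[symmetric] term_eq of_nat_diff)
    qed
    ultimately show ?thesis using upper unfolding ramsey_good_def by linarith
  qed
  ultimately show ?thesis by blast
qed

end
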